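(* Let $p$ be an odd prime, $r\ge1$, $q=p^r$, and suppose $-1$ is a quadratic non-residue in $GF(q)$. Let $m\ge 1$, let $\alpha\in GF(q^m)$ be an element of multiplicative order $N$, and let $v=(v_0,v_1,\dots,v_{N-1})$ be a vector with components in $GF(q)$. Let $V=(V_0,\dots,V_{N-1})$ be the finite field Hartley transform of $v$, i.e. $$V_k=\sum_{i=0}^{N-1}v_i\,\mathrm{cas}_k(\angle\alpha^i),\qquad k=0,1,\dots,N-1.$$ Then $v$ is recovered from $V$ by $$v_i=\frac{1}{N \,(\mathrm{mod}\ p)}\sum_{k=0}^{N-1}V_k\,\mathrm{cas}_k(\angle\alpha^i),\qquad i=0,1,\dots,N-1.$$
   Context: $GF(q)$ is the finite field with $q$ elements. Let $j$ be a fixed element of an algebraic closure of $GF(q^m)$ with $j^2=-1$, and let $K=GF(q^m)(j)$; all computations take place in $K$. (If $-1$ is a non-residue in $GF(q^m)$, then $K=GI(q^m)=\{a+jb: a,b\in GF(q^m)\}$, the field of Gaussian integers over $GF(q^m)$; otherwise $K=GF(q^m)$.) For $\alpha\in GF(q^m)$ of multiplicative order $N$ and $i,k\in\{0,\dots,N-1\}$, define the elements of $K$ $$\cos_k(\angle\alpha^i):=\tfrac12(\alpha^{ik}+\alpha^{-ik}),\qquad \sin_k(\angle\alpha^i):=\tfrac{1}{2j}(\alpha^{ik}-\alpha^{-ik}),\qquad \mathrm{cas}_k(\angle\alpha^i):=\cos_k(\angle\alpha^i)+\sin_k(\angle\alpha^i).$$ The symbol $\angle$ is only notation. $N\,(\mathrm{mod}\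 p)$ denotes the image of the integer $N$ in the prime field $GF(p)$. *)

theory Defs
  imports "HOL-Algebra.Algebraic_Closure_Type"
begin

definition is_subfield :: "'a::field set \<Rightarrow> bool" where
  "is_subfield F \<longleftrightarrow> 0 \<in> F \<and> 1 \<in> F \<and> (\<forall>x\<in>F. - x \<in> F \<and> inverse x \<in> F) \<and>
     (\<forall>x\<in>F. \<forall>y\<in>F. x + y \<in> F \<and> x * y \<in> F)"

definition has_mult_order :: "'a::field \<Rightarrow> nat \<Rightarrow> bool" where
  "has_mult_order x N \<longleftrightarrow> N > 0 \<and> x ^ N = 1 \<and> (\<forall>n. 0 < n \<and> n < N \<longrightarrow> x ^ n \<noteq> 1)"

text \<open>
  In the trigonometric functions the angle argument is the power \<open>\<alpha> ^ i\<close>, kept as the pair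
  \<open>\<alpha>\<close>, \<open>i\<close>; the exponent \<open>- i * k\<close> is a genuine negative integer power.
\<close>

definition ff_cos :: "'k::field \<Rightarrow> nat \<Rightarrow> nat \<Rightarrow> 'k" where
  "ff_cos \<alpha> k i = 1 / 2 * (\<alpha> powi (int i * int k) + \<alpha> powi (- (int i * int k)))"

definition ff_sin :: "'k::field \<Rightarrow> 'k \<Rightarrow> nat \<Rightarrow> nat \<Rightarrow> 'k" where
  "ff_sin j \<alpha> k i = 1 / (2 * j) * (\<alpha> powi (int i * int k) - \<alpha> powi (- (int i * int k)))"

definition ff_cas :: "'k::field \<Rightarrow> 'k \<Rightarrow> nat \<Rightarrow> nat \<Rightarrow> 'k" where
  "ff_cas j \<alpha> k i = ff_cos \<alpha> k i + ff_sin j \<alpha> k i"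

definition ff_hartley :: "'k::field \<Rightarrow> 'k \<Rightarrow> nat \<Rightarrow> (nat \<Rightarrow> 'k) \<Rightarrow> nat \<Rightarrow> 'k" where
  "ff_hartley j \<alpha> N v k = (\<Sum>i<N. v i * ff_cas j \<alpha> k i)"

text \<open>
  With \<open>'a\<close> in the role of \<open>GF(q^m)\<close>, the field \<open>K = GF(q^m)(j)\<close> inside the algebraic closure
  \<open>'a alg_closure\<close>. An equation between elements of \<open>K\<close> may be stated in the algebraic
  closure; the membership lemmas below show that the transform stays inside \<open>K\<close>.
\<close>

definition adjoin :: "'a::field alg_closure \<Rightarrow> 'a alg_closure set" where
  "adjoin j = is_subfield hull (insert j (range to_ac))"

lemma is_subfield_adjoin: "is_subfield (adjoin j)"
  unfolding adjoin_def by (rule hull_in) (auto simp: is_subfield_def)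

lemma gen_in_adjoin: "j \<in> adjoin j"
  and to_ac_in_adjoin: "to_ac a \<in> adjoin j"
  using hull_subset[of "insert j (range to_ac)" is_subfield] by (auto simp: adjoin_def)

lemma ff_cas_in_adjoin: "ff_cas j (to_ac \<alpha>) k i \<in> adjoin j"
proof -
  let ?K = "adjoin j" and ?t = "to_ac (\<alpha> ^ (i * k))"
  have add: "x + y \<in> ?K" and mult: "x * y \<in> ?K" if "x \<in> ?K" "y \<in> ?K" for x y
    using is_subfield_adjoin[of j] that unfolding is_subfield_def by auto
  have neg: "- x \<in> ?K" and inv: "inverse x \<in> ?K" if "x \<in> ?K" for x
    using is_subfield_adjoin[of j] that unfolding is_subfield_def by auto
  have two: "2 \<in> ?K"
    using to_ac_in_adjoin[of 2 j] by simp
  have t: "?t \<in> ?K" by (rule to_ac_in_adjoin)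
  have pow: "to_ac \<alpha> powi (int i * int k) = ?t" "to_ac \<alpha> powi (- (int i * int k)) = inverse ?t"
    by (simp_all add: power_int_minus flip: of_nat_mult)
  have "ff_cas j (to_ac \<alpha>) k i =
      inverse 2 * (?t + inverse ?t) + inverse (2 * j) * (?t + - inverse ?t)"
    unfolding ff_cas_def ff_cos_def ff_sin_def pow
    by (simp only: inverse_eq_divide diff_conv_add_uminus)
  also have "\<dots> \<in> ?K"
    by (intro add mult neg inv t two gen_in_adjoin)
  finally show ?thesis .
qed

lemma ff_hartley_in_adjoin: "ff_hartley j (to_ac \<alpha>) N (\<lambda>i. to_ac (v i)) k \<in> adjoin j"
proof -
  have "(\<Sum>i<n. to_ac (v i) * ff_cas j (to_ac \<alpha>) k i) \<in> adjoin j" for n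
    using is_subfield_adjoin[of j] to_ac_in_adjoin[of _ j] ff_cas_in_adjoin[of j \<alpha> k]
    by (induction n) (auto simp: is_subfield_def)
  then show ?thesis by (simp add: ff_hartley_def)
qed

text \<open>The order of an element is invertible in the field, so dividing by it is meaningful.\<close>

lemma of_nat_mult_order_neq_0:
  fixes x :: "'a::field"
  assumes "has_mult_order x N"
  shows "of_nat N \<noteq> (0 :: 'a)"
proof
  assume "of_nat N = (0 :: 'a)"
  then obtain n where n: "N = CHAR('a) * n"
    by (auto simp: of_nat_eq_0_iff_char_dvd)
  have "N > 0" using assms by (simp add: has_mult_order_def)
  with n have pos: "CHAR('a) > 0" "n > 0" by auto
  then have prime: "prime CHAR('a)" by (intro prime_CHAR_semidom)
  have "(x ^ n - 1) ^ CHAR('a) + 1 = (x ^ n - 1 + 1) ^ CHAR('a)"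
    using freshmans_dream[OF prime refl, of "x ^ n - 1" 1] by simp
  also have "\<dots> = 1"
    using assms by (simp add: has_mult_order_def n mult.commute flip: power_mult)
  finally have "x ^ n = 1" using pos by simp
  moreover have "n < N" using n pos prime_gt_1_nat[OF prime] by simp
  ultimately show False using assms pos by (auto simp: has_mult_order_def)
qed

end

theory Submission
  imports Defs
begin

text \<open>
  With \<open>A = (1 - j) / 2\<close> and \<open>B = (1 + j) / 2\<close> one has \<open>cas u = A u + B / u\<close> for a power \<open>u\<close> of
  \<open>\<alpha>\<close>, where \<open>A\<^sup>2 + B\<^sup>2 = 0\<close> and \<open>2 A B = 1\<close>. Hence in
  \<open>cas u cas w = A\<^sup>2 u w + B\<^sup>2 / (u w) + A B (u / w + w / u)\<close> the first two terms cancel after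
  summation over \<open>k\<close>, because a sum of all powers of a root of unity is unchanged by inverting it,
  and the mixed terms are geometric sums that vanish unless \<open>u = w\<close>. So the cas functions are
  orthogonal and the transform is its own inverse up to the factor \<open>N\<close>.
\<close>

text \<open>Multiplying by \<open>z - 1\<close> telescopes the sum to \<open>z ^ N - 1 = 0\<close>,
  and a field has no zero divisors.\<close>

lemma sum_powers_root_of_unity:
  fixes z :: "'k::field"
  assumes "z ^ N = 1"
  shows "(\<Sum>k<N. z ^ k) = (if z = 1 then of_nat N else 0)"
proof -
  have "(z - 1) * (\<Sum>k<N. z ^ k) = 0"
    using assms by (simp flip: power_diff_1_eq)
  then show ?thesis by auto
qed

lemma has_mult_order_power_eq_iff:
  fixes a :: "'k::field"
  assumes "has_mult_order a N" "i < N" "l < N"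
  shows "a ^ i = a ^ l \<longleftrightarrow> i = l"
proof -
  have "a \<noteq> 0"
    using assms(1) by (auto simp: has_mult_order_def power_0_left)
  have ne: "a ^ s \<noteq> a ^ t" if "s < t" "t < N" for s t
  proof
    assume "a ^ s = a ^ t"
    also have "a ^ t = a ^ s * a ^ (t - s)"
      using that by (simp flip: power_add)
    finally have "a ^ (t - s) = 1"
      using \<open>a \<noteq> 0\<close> by simp
    then show False
      using assms(1) that by (auto simp: has_mult_order_def)
  qed
  show ?thesis
    using ne[of i l] ne[of l i] assms(2,3) by (metis linorder_neqE_nat)
qed

text \<open>The embedding \<open>to_ac\<close> is injective and multiplicative. This lets the
  inversion be carried out inside the algebraic closure.\<close>

lemma has_mult_order_to_ac: "has_mult_order (to_ac x) N \<longleftrightarrow> has_mult_order x N"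
proof -
  have "to_ac x ^ n = 1 \<longleftrightarrow> x ^ n = 1" for n
    by (simp flip: to_ac_power)
  then show ?thesis
    by (simp add: has_mult_order_def)
qed

lemma ff_cas_conv_powers:
  fixes j :: "'k::field"
  assumes "j ^ 2 = -1"
  shows "ff_cas j a k i = (1 - j) / 2 * (a ^ i) ^ k + (1 + j) / 2 * inverse (a ^ i) ^ k"
proof -
  have "j * j = -1"
    using assms by (simp add: power2_eq_square)
  \<comment> \<open>This turns the factor \<open>1 / (2 * j)\<close> of the sine into
    \<open>- j / 2\<close>, which yields the coefficients \<open>(1 - j) / 2\<close> and
    \<open>(1 + j) / 2\<close>.\<close>
  then have inv: "inverse j = - j"
    by (intro inverse_unique) simp
  have pow: "a powi (int i * int k) = (a ^ i) ^ k"
    "a powi (- (int i * int k)) = inverse (a ^ i) ^ k"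
    by (simp_all add: power_int_minus power_mult power_inverse flip: of_nat_mult)
  show ?thesis
    unfolding ff_cas_def ff_cos_def ff_sin_def pow divide_inverse inverse_mult_distrib inv
    by (simp only: ring_distribs mult_minus_left mult_minus_right mult_1_left mult_1_right
        diff_conv_add_uminus minus_minus mult_ac add_ac)
qed

lemma ff_cas_orthogonal:
  fixes j :: "'k::field"
  assumes two: "(2 :: 'k) \<noteq> 0" and j: "j ^ 2 = -1"
    and a: "has_mult_order a N" and "i < N" "l < N"
  shows "(\<Sum>k<N. ff_cas j a k i * ff_cas j a k l) = (if i = l then of_nat N else 0)"
proof -
  define u w where "u = a ^ i" and "w = a ^ l"
  define S where "S z = (\<Sum>k<N. z ^ k)" for z :: 'k
  have "a \<noteq> 0"
    using a by (auto simp: has_mult_order_def power_0_left)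
  then have "u \<noteq> 0" "w \<noteq> 0"
    by (simp_all add: u_def w_def)
  have "(a ^ n) ^ N = 1" for n
    using a by (metis has_mult_order_def mult.commute power_mult power_one)
  then have root: "u ^ N = 1" "w ^ N = 1"
    by (simp_all add: u_def w_def)
  have S: "S z = (if z = 1 then of_nat N else 0)" if "z ^ N = 1" for z
    unfolding S_def using that by (rule sum_powers_root_of_unity)
  \<comment> \<open>The inverse is again an \<open>N\<close>-th root of unity and equals 1 exactly
    when \<open>z\<close> does.\<close>
  have sym: "S (inverse z) = S z" if "z ^ N = 1" for z
    using that by (simp add: S power_inverse)
  have "u / w = 1 \<longleftrightarrow> i = l"
    using \<open>w \<noteq> 0\<close> has_mult_order_power_eq_iff[OF a \<open>i < N\<close> \<open>l < N\<close>] by (simp add: u_def w_def)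
  then have diag: "S (u / w) = (if i = l then of_nat N else 0)"
    using root by (simp add: S power_divide)
  define A B where "A = (1 - j) / 2" and "B = (1 + j) / 2"
  \<comment> \<open>By \<open>j ^ 2 = -1\<close>, the squares are \<open>- j / 2\<close> and
    \<open>j / 2\<close>, and the product is \<open>(1 - j ^ 2) / 4 = 1 / 2\<close>.\<close>
  have coeffs: "A * A + B * B = 0" "2 * (A * B) = 1"
    using two j by (simp_all add: A_def B_def field_simps power2_eq_square)
  have inv: "S (inverse (u * w)) = S (u * w)" "S (inverse (u / w)) = S (u / w)"
    using root by (intro sym; simp add: power_mult_distrib power_divide)+
  have "(\<Sum>k<N. ff_cas j a k i * ff_cas j a k l) =
      A * A * S (u * w) + B * B * S (inverse (u * w)) + A * B * (S (u / w) + S (inverse (u / w)))"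
    unfolding ff_cas_conv_powers[OF j] S_def A_def[symmetric] B_def[symmetric]
      u_def[symmetric] w_def[symmetric]
    by (simp add: sum_distrib_left power_mult_distrib divide_inverse algebra_simps
        flip: sum.distrib)
  also have "\<dots> = (A * A + B * B) * S (u * w) + 2 * (A * B) * S (u / w)"
    by (simp only: inv) (simp only: algebra_simps mult_2)
  also have "\<dots> = S (u / w)"
    by (simp add: coeffs)
  finally show ?thesis
    by (simp add: diag)
qed

text \<open>After the two sums are exchanged, orthogonality leaves only the term
  \<open>l = i\<close>, which is \<open>v i * of_nat N\<close>.\<close>

lemma ff_hartley_inversion:
  fixes j :: "'k::field"
  assumes "(2 :: 'k) \<noteq> 0" "j ^ 2 = -1" "has_mult_order a N" "i < N"
  shows "v i = 1 / of_nat N * (\<Sum>k<N. ff_hartley j a N v k * ff_cas j a k i)"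
proof -
  have "(\<Sum>k<N. ff_hartley j a N v k * ff_cas j a k i) =
      (\<Sum>k<N. \<Sum>l<N. v l * (ff_cas j a k l * ff_cas j a k i))"
    by (simp add: ff_hartley_def sum_distrib_right mult.assoc)
  also have "\<dots> = (\<Sum>l<N. v l * (\<Sum>k<N. ff_cas j a k l * ff_cas j a k i))"
    unfolding sum_distrib_left by (rule sum.swap)
  also have "\<dots> = (\<Sum>l<N. if l = i then v l * of_nat N else 0)"
    using assms by (intro sum.cong) (auto simp: ff_cas_orthogonal)
  also have "\<dots> = v i * of_nat N"
    using \<open>i < N\<close> by simp
  \<comment> \<open>The characteristic does not divide the order \<open>N\<close>, so the factor
    \<open>of_nat N\<close> cancels.\<close>
  finally show ?thesis
    using of_nat_mult_order_neq_0[OF assms(3)] by simp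
qed

theorem theorem2:
  fixes p r q m N :: nat
    and F :: "'a::{field,finite} set"
    and \<alpha> :: 'a
    and v :: "nat \<Rightarrow> 'a"
    and j :: "'a alg_closure"
    and V :: "nat \<Rightarrow> 'a alg_closure"
  assumes "prime p" and "odd p" and "r \<ge> 1" and "q = p ^ r" and "m \<ge> 1"
    and "card (UNIV :: 'a set) = q ^ m"
    and "is_subfield F" and "card F = q"
    and "\<not> (\<exists>x\<in>F. x ^ 2 = -1)"
    and "j ^ 2 = -1"
    and "has_mult_order \<alpha> N"
    and "\<forall>i<N. v i \<in> F"
    and "\<forall>k<N. V k = ff_hartley j (to_ac \<alpha>) N (\<lambda>i. to_ac (v i)) k"
  shows "\<forall>i<N. to_ac (v i) = 1 / of_nat N * (\<Sum>k<N. V k * ff_cas j (to_ac \<alpha>) k i)"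
proof (intro allI impI)
  fix i assume "i < N"
  \<comment> \<open>In characteristic 2 the element \<open>1 = -1\<close> of \<open>F\<close> would be a square.\<close>
  have "(2 :: 'a) \<noteq> 0"
  proof
    assume "(2 :: 'a) = 0"
    then have "(1 :: 'a) ^ 2 = -1"
      by (simp add: eq_neg_iff_add_eq_0)
    moreover have "1 \<in> F"
      using \<open>is_subfield F\<close> by (simp add: is_subfield_def)
    ultimately show False
      using assms(9) by blast
  qed
  \<comment> \<open>Injectivity of \<open>to_ac\<close> carries \<open>2 \<noteq> 0\<close> over to
    the closure.\<close>
  then have "to_ac (2 :: 'a) \<noteq> 0"
    by (simp only: to_ac_eq_0_iff not_False_eq_True)
  then have two: "(2 :: 'a alg_closure) \<noteq> 0"
    by simp
  have "to_ac (v i) = 1 / of_nat N *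
      (\<Sum>k<N. ff_hartley j (to_ac \<alpha>) N (\<lambda>i. to_ac (v i)) k * ff_cas j (to_ac \<alpha>) k i)"
    using two \<open>j ^ 2 = -1\<close> \<open>has_mult_order \<alpha> N\<close> \<open>i < N\<close>
    by (intro ff_hartley_inversion) (simp_all add: has_mult_order_to_ac)
  also have "\<dots> = 1 / of_nat N * (\<Sum>k<N. V k * ff_cas j (to_ac \<alpha>) k i)"
    using assms(13) by simp
  finally show "to_ac (v i) = 1 / of_nat N * (\<Sum>k<N. V k * ff_cas j (to_ac \<alpha>) k i)" .
qed

end
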